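(* Let $q\in(0,1)$ and $\kappa\in\mathbf{i}\mathbb{R}_{>0}$ be fixed, and let $\mathsf T>\mathsf S>0$, $\mathsf T>\mathsf N>0$. Let $L\to+\infty$ with $T=\lfloor L\mathsf T\rfloor$, $S=\lfloor L\mathsf S\rfloor$, $N=\lfloor L\mathsf N\rfloor$, $t=\lfloor L\mathsf t\rfloor$, $x=\lfloor L\mathsf x\rfloor+\Delta x$, where $\Delta x\in\mathbb{Z}$ is fixed, $\mathsf t_l<\mathsf t<\mathsf t_r$, and $(\mathsf t,\mathsf x)\in\mathcal H$. Let $a_L(\Delta x)$ be the diagonal coefficient and $d_L(\Delta x)$ the off-diagonal coefficient of the shifted and rescaled $q$-Racah difference operator (all notation is in the context). Then $a_L(\Delta x)\to a(\Delta x)$ and $d_L(\Delta x)\to d(\Delta x)$ as $L\to+\infty$, where: (1) if $|2\mathsf x-\mathsf S-\mathsf t|>\mathsf N$, then $d(\Delta x)=0$ and $a(\Delta x)=-1$; (2) if $2\mathsf x=\mathsf S+\mathsf t+\mathsf N$ and $\lfloor L\mathsf x\rfloor=\frac12(S+t+N)$, then $d(\Delta x)=-\kappa^2q^{2\Delta x+1/2}$ and $a(\Delta x)=-1-\kappa^2(1+q)q^{2\Delta x+1}$; (3) if $2\mathsf x=\mathsf S+\mathsf t-\mathsf N$ and $\lfloor L\mathsf x\rfloor=\frac12(S+t-N)$, then $d(\Delta x)=-\kappa^{-2}q^{-2\Delta x+1/2}$ and $a(\Delta x)=-1-\kappa^{-2}(1+q)q^{-2\Delta x-1}$; (4) if $\mathsf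 S+\mathsf t<2\mathsf x<\mathsf S+\mathsf t+\mathsf N$, then $d(\Delta x)=-\kappa^2q^{2\Delta x+1/2}$ and $a(\Delta x)=-\kappa^2(1+q)q^{2\Delta x+1}$; (5) if $\mathsf S+\mathsf t-\mathsf N<2\mathsf x<\mathsf S+\mathsf t$, then $d(\Delta x)=-\kappa^{-2}q^{-2\Delta x+1/2}$ and $a(\Delta x)=-\kappa^{-2}(1+q)q^{-2\Delta x-1}$; (6) if $2\mathsf x=\mathsf S+\mathsf t$ and $\lfloor L\mathsf x\rfloor=\frac12(S+t)$, then $$d(\Delta x)=\frac{-\kappa^2q^{2\Delta x+1/2}}{(1-\kappa^2q^{2\Delta x})\sqrt{(1-\kappa^2q^{2\Delta x-1})(1-\kappa^2q^{2\Delta x+1})}},\qquad a(\Delta x)=\frac{-\kappa^2(1+q)q^{2\Delta x+1}}{(1-\kappa^2q^{2\Delta x})(1-\kappa^2q^{2\Delta x+2})}.$$ In the border cases (2), (3), (6), the limit is taken along those $L$ for which the stated integer identity for $\lfloor L\mathsf x\rfloor$ holds.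
   Context: Scaled hexagon: $\mathcal H=\{(\mathsf t,\mathsf x):0<\mathsf t<\mathsf T,\ \max(0,\mathsf t-\mathsf T+\mathsf S)<\mathsf x<\min(\mathsf S+\mathsf N,\mathsf t+\mathsf N)\}$. Also $\mathsf t_l=|\mathsf N-\mathsf S|$ and $\mathsf t_r=\min(\mathsf N+\mathsf S,\,2\mathsf T-\mathsf N-\mathsf S)$. Since $\kappa\in\mathbf i\mathbb R_{>0}$, $-\kappa^2>0$. For real $a$, $a^+=\max(a,0)$. For integers $T,S,N,t$ and $x$ on the $t$-th slice $I_t=\{x\in\mathbb Z:\max(0,t+S-T)\le x\le\min(t+N-1,S+N-1)\}$ put $$B(x)=\frac{q^{-2N-T}(q^T-\kappa^2q^{x+1})(q^{N+S}-q^{x+1})(q^{N+t}-q^{x+1})(q^{S+t}-\kappa^2q^{x+1})}{(q^{S+t}-\kappa^2q^{2x+1})(q^{S+t}-\kappa^2q^{2x+2})},$$ $$D(x)=\frac{(1-q^x)q^{-2N-T+1}(q^S-\kappa^2q^{N+x})(q^t-\kappa^2q^{N+x})(q^{S+t}-q^{T+x})}{(q^{S+t}-\kappa^2q^{2x})(q^{S+t}-\kappa^2q^{2x+1})}.$$ Let $w_t$ be the ($q$-Racah) positive weight on $I_t$, determined up to a constant factor by $$\frac{w_t(x)}{w_t(x+1)}=\frac{q(1-q^{x+1})(q^S-\kappa^2q^{N+x+1})(q^t-\kappa^2q^{N+x+1})(q^{S+t}-\kappa^2q^{2x+1})(q^{S+t}-q^{T+x+1})}{(q^T-\kappa^2q^{x+1})(q^{N+S}-q^{x+1})(q^{N+t}-q^{x+1})(q^{S+t}-\kappa^2q^{x+1})(q^{S+t}-\kappa^2q^{2x+3})}.$$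 The symmetric difference operator is $(\mathfrak Dg)(x)=\sqrt{\tfrac{w_t(x)}{w_t(x+1)}}B(x)g(x+1)-[B(x)+D(x)]g(x)+\sqrt{\tfrac{w_t(x)}{w_t(x-1)}}D(x)g(x-1)$, where $\sqrt{\tfrac{w_t(x-1)}{w_t(x)}}B(x-1)=\sqrt{\tfrac{w_t(x)}{w_t(x-1)}}D(x)$. The shifted and rescaled operator is $\mathfrak D^{\mathrm{scaled}}g=C_{\mathsf x}\bigl[\mathfrak Dg+q^{-N+1}(1-q^{N-1})(q^{-T-N}-1)g\bigr]$ with $C_{\mathsf x}=q^{N+T+(N-|2\lfloor L\mathsf x\rfloor-S-t|)^+}$. Its coefficients at $x=\lfloor L\mathsf x\rfloor+\Delta x$ are $$a_L(\Delta x)=C_{\mathsf x}\bigl(q^{-N+1}(1-q^{N-1})(q^{-T-N}-1)-B(x)-D(x)\bigr),$$ $$d_L(\Delta x)=C_{\mathsf x}\sqrt{\frac{w_t(x)}{w_t(x-1)}}\,D(x)=C_{\mathsf x}\sqrt{\frac{w_t(x-1)}{w_t(x)}}\,B(x-1),$$ so that the limiting operator is $(\mathcal{T}g)(\Delta x)=d(\Delta x+1)g(\Delta x+1)+a(\Delta x)g(\Delta x)+d(\Delta x)g(\Delta x-1)$. *)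

theory Defs
  imports "HOL-Analysis.Analysis"
begin

text \<open>
  In all definitions the parameter \<open>K\<close> is the negative real number \<open>\<kappa>\<^sup>2\<close>, where
  \<open>\<kappa>\<close> is purely imaginary; \<open>\<kappa>\<close> enters the formulas only through its square.
  Primed reals \<open>T' S' N' t' x'\<close> are the macroscopic counterparts of the integers \<open>T S N t x\<close>.
\<close>

definition hexagon :: "real \<Rightarrow> real \<Rightarrow> real \<Rightarrow> (real \<times> real) set" where
  "hexagon T' S' N' = {(t', x'). 0 < t' \<and> t' < T' \<and>
     max 0 (t' - T' + S') < x' \<and> x' < min (S' + N') (t' + N')}"

definition t_left :: "real \<Rightarrow> real \<Rightarrow> real" where
  "t_left S' N' = \<bar>N' - S'\<bar>"

definition t_right :: "real \<Rightarrow> real \<Rightarrow> real \<Rightarrow> real" where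
  "t_right T' S' N' = min (N' + S') (2 * T' - N' - S')"

definition slice :: "int \<Rightarrow> int \<Rightarrow> int \<Rightarrow> int \<Rightarrow> int set" where
  "slice T S N t = {x. max 0 (t + S - T) \<le> x \<and> x \<le> min (t + N - 1) (S + N - 1)}"

definition B_coeff :: "real \<Rightarrow> real \<Rightarrow> int \<Rightarrow> int \<Rightarrow> int \<Rightarrow> int \<Rightarrow> int \<Rightarrow> real" where
  "B_coeff q K T S N t x =
     (q powi (-2*N - T) * (q powi T - K * q powi (x + 1)) * (q powi (N + S) - q powi (x + 1))
        * (q powi (N + t) - q powi (x + 1)) * (q powi (S + t) - K * q powi (x + 1)))
     / ((q powi (S + t) - K * q powi (2*x + 1)) * (q powi (S + t) - K * q powi (2*x + 2)))"

definition D_coeff :: "real \<Rightarrow> real \<Rightarrow> int \<Rightarrow> int \<Rightarrow> int \<Rightarrow> int \<Rightarrow> int \<Rightarrow> real" where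
  "D_coeff q K T S N t x =
     ((1 - q powi x) * q powi (-2*N - T + 1) * (q powi S - K * q powi (N + x))
        * (q powi t - K * q powi (N + x)) * (q powi (S + t) - q powi (T + x)))
     / ((q powi (S + t) - K * q powi (2*x)) * (q powi (S + t) - K * q powi (2*x + 1)))"

definition racah_ratio :: "real \<Rightarrow> real \<Rightarrow> int \<Rightarrow> int \<Rightarrow> int \<Rightarrow> int \<Rightarrow> int \<Rightarrow> real" where
  "racah_ratio q K T S N t x =
     (q * (1 - q powi (x + 1)) * (q powi S - K * q powi (N + x + 1))
        * (q powi t - K * q powi (N + x + 1)) * (q powi (S + t) - K * q powi (2*x + 1))
        * (q powi (S + t) - q powi (T + x + 1)))
     / ((q powi T - K * q powi (x + 1)) * (q powi (N + S) - q powi (x + 1))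
        * (q powi (N + t) - q powi (x + 1)) * (q powi (S + t) - K * q powi (x + 1))
        * (q powi (S + t) - K * q powi (2*x + 3)))"

text \<open>
  The weight is only determined up to a positive constant factor, so it is a predicate.
  Nothing is required of \<open>w\<close> outside the slice.
\<close>

definition racah_weight ::
  "real \<Rightarrow> real \<Rightarrow> int \<Rightarrow> int \<Rightarrow> int \<Rightarrow> int \<Rightarrow> (int \<Rightarrow> real) \<Rightarrow> bool" where
  "racah_weight q K T S N t w \<longleftrightarrow>
     (\<forall>x\<in>slice T S N t. w x > 0) \<and>
     (\<forall>x. x \<in> slice T S N t \<and> x + 1 \<in> slice T S N t \<longrightarrow>
        w x / w (x + 1) = racah_ratio q K T S N t x)"

definition racah_op ::
  "real \<Rightarrow> real \<Rightarrow> int \<Rightarrow> int \<Rightarrow> int \<Rightarrow> int \<Rightarrow> (int \<Rightarrow> real) \<Rightarrow> (int \<Rightarrow> real) \<Rightarrow> int \<Rightarrow> real" where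
  "racah_op q K T S N t w g x =
     sqrt (w x / w (x + 1)) * B_coeff q K T S N t x * g (x + 1)
     - (B_coeff q K T S N t x + D_coeff q K T S N t x) * g x
     + sqrt (w x / w (x - 1)) * D_coeff q K T S N t x * g (x - 1)"

definition spectral_shift :: "real \<Rightarrow> int \<Rightarrow> int \<Rightarrow> real" where
  "spectral_shift q T N = q powi (-N + 1) * (1 - q powi (N - 1)) * (q powi (-T - N) - 1)"

text \<open>The scaling prefactor depends on the base point \<open>X = \<lfloor>L x'\<rfloor>\<close>, not on the running point \<open>x\<close>.\<close>

definition scale_factor :: "real \<Rightarrow> int \<Rightarrow> int \<Rightarrow> int \<Rightarrow> int \<Rightarrow> int \<Rightarrow> real" where
  "scale_factor q T S N t X = q powi (N + T + max (N - \<bar>2*X - S - t\<bar>) 0)"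

definition racah_op_scaled ::
  "real \<Rightarrow> real \<Rightarrow> int \<Rightarrow> int \<Rightarrow> int \<Rightarrow> int \<Rightarrow> (int \<Rightarrow> real) \<Rightarrow> int
     \<Rightarrow> (int \<Rightarrow> real) \<Rightarrow> int \<Rightarrow> real" where
  "racah_op_scaled q K T S N t w X g x =
     scale_factor q T S N t X * (racah_op q K T S N t w g x + spectral_shift q T N * g x)"

definition diag_coeff ::
  "real \<Rightarrow> real \<Rightarrow> int \<Rightarrow> int \<Rightarrow> int \<Rightarrow> int \<Rightarrow> int \<Rightarrow> int \<Rightarrow> real" where
  "diag_coeff q K T S N t X \<Delta> =
     scale_factor q T S N t X *
       (spectral_shift q T N - B_coeff q K T S N t (X + \<Delta>) - D_coeff q K T S N t (X + \<Delta>))"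

definition offdiag_coeff ::
  "real \<Rightarrow> real \<Rightarrow> int \<Rightarrow> int \<Rightarrow> int \<Rightarrow> int \<Rightarrow> (int \<Rightarrow> real) \<Rightarrow> int \<Rightarrow> int \<Rightarrow> real" where
  "offdiag_coeff q K T S N t w X \<Delta> =
     scale_factor q T S N t X *
       sqrt (w (X + \<Delta>) / w (X + \<Delta> - 1)) * D_coeff q K T S N t (X + \<Delta>)"

lemma racah_denominator_pos:
  fixes q K :: real
  assumes "0 < q" "K < 0"
  shows "q powi a - K * q powi b > 0"
proof -
  have "q powi a > 0" "q powi b > 0" using assms by simp_all
  then have "K * q powi b < 0" using assms by (simp add: mult_neg_pos)
  with \<open>q powi a > 0\<close> show ?thesis by linarith
qed

lemma racah_signs:
  fixes q :: real
  assumes q: "0 < q" "q < 1" and x: "x \<in> slice T S N t" "x + 1 \<in> slice T S N t"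
  shows "q powi (N + S) < q powi (x + 1)" "q powi (N + t) < q powi (x + 1)"
    "q powi (T + x + 1) < q powi (S + t)" "q powi (x + 1) < 1"
proof -
  have mono: "q powi b < q powi a" if "a < b" for a b :: int
    using that q by (intro power_int_strict_decreasing) auto
  show "q powi (N + S) < q powi (x + 1)" "q powi (N + t) < q powi (x + 1)"
    "q powi (T + x + 1) < q powi (S + t)"
    using x by (auto intro!: mono simp: slice_def)
  show "q powi (x + 1) < 1"
    using mono[of 0 "x + 1"] x by (auto simp: slice_def)
qed

lemma racah_ratio_pos:
  assumes q: "0 < q" "q < 1" and K: "K < 0"
    and x: "x \<in> slice T S N t" "x + 1 \<in> slice T S N t"
  shows "racah_ratio q K T S N t x > 0"
proof -
  note p = racah_denominator_pos[OF q(1) K] and s = racah_signs[OF q x]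
  have pn: "0 < a * b * c" if "a > 0" "b < 0" "c < 0" for a b c :: real
    using that by (simp add: mult_pos_neg mult_neg_neg)
  show ?thesis
    unfolding racah_ratio_def
    using q s by (intro divide_pos_pos mult_pos_pos pn p) auto
qed

lemma racah_weight_exists:
  assumes q: "0 < q" "q < 1" and K: "K < 0"
  shows "\<exists>w. racah_weight q K T S N t w"
proof -
  define lo where "lo = max 0 (t + S - T)"
  define w where "w = (\<lambda>x. \<Prod>y\<in>{lo..<x}. 1 / racah_ratio q K T S N t y)"
  have r: "racah_ratio q K T S N t y > 0" if "lo \<le> y" "y < x" "x \<in> slice T S N t" for x y
    using that by (intro racah_ratio_pos q K) (auto simp: slice_def lo_def)
  have pos: "w x > 0" if "x \<in> slice T S N t" for x
    unfolding w_def using r that by (intro prod_pos) auto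
  have "w x / w (x + 1) = racah_ratio q K T S N t x"
    if x: "x \<in> slice T S N t" "x + 1 \<in> slice T S N t" for x
  proof -
    have "{lo..<x + 1} = insert x {lo..<x}" using x by (auto simp: slice_def lo_def)
    then have "w (x + 1) = 1 / racah_ratio q K T S N t x * w x"
      by (simp add: w_def)
    then show ?thesis using pos[OF x(1)] racah_ratio_pos[OF q K x] by simp
  qed
  with pos show ?thesis unfolding racah_weight_def by blast
qed

lemma racah_ratio_D_B:
  assumes q: "0 < q" "q < 1" and K: "K < 0"
    and x: "x \<in> slice T S N t" "x + 1 \<in> slice T S N t"
  shows "D_coeff q K T S N t (x + 1) = racah_ratio q K T S N t x * B_coeff q K T S N t x"
proof -
  note p = racah_denominator_pos[OF q(1) K] and s = racah_signs[OF q x]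
  have e: "2 * (x + 1) = 2 * x + 2" "2 * x + 2 + 1 = 2 * x + 3" "N + (x + 1) = N + x + 1"
    "T + (x + 1) = T + x + 1" by simp_all
  have "q powi (-2*N - T + 1) = q * q powi (-2*N - T)"
    using q by (simp add: power_int_add_1')
  moreover have nz: "q powi (N + S) - q powi (x + 1) \<noteq> 0" "q powi (N + t) - q powi (x + 1) \<noteq> 0"
    using s by auto
  have pz: "\<And>a b. q powi a - K * q powi b \<noteq> 0" using p by (metis less_irrefl)
  have alg: "u * (q0 * Q) * c * d * e1 / (f * g)
      = q0 * u * c * d * h * e1 / (i * j * k * l * g) * (Q * i * j * k * l / (h * f))"
    if "f \<noteq> 0" "g \<noteq> 0" "h \<noteq> 0" "i \<noteq> 0" "j \<noteq> 0" "k \<noteq> 0" "l \<noteq> 0"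
    for u q0 Q c d e1 f g h i j k l :: real
    using that by (simp add: field_simps)
  ultimately show ?thesis
    unfolding D_coeff_def racah_ratio_def B_coeff_def e
    by (simp only:) (rule alg; rule nz pz)
qed

lemma offdiag_symmetric:
  assumes q: "0 < q" "q < 1" and K: "K < 0" and w: "racah_weight q K T S N t w"
    and x: "x \<in> slice T S N t" "x - 1 \<in> slice T S N t"
  shows "sqrt (w x / w (x - 1)) * D_coeff q K T S N t x
       = sqrt (w (x - 1) / w x) * B_coeff q K T S N t (x - 1)"
proof -
  have pos: "w x > 0" "w (x - 1) > 0" using w x by (auto simp: racah_weight_def)
  have "w (x - 1) / w (x - 1 + 1) = racah_ratio q K T S N t (x - 1)"
    using w x unfolding racah_weight_def by (metis diff_add_cancel)
  then have D: "D_coeff q K T S N t x = w (x - 1) / w x * B_coeff q K T S N t (x - 1)"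
    using racah_ratio_D_B[OF q K, of "x - 1" T S N t] x by simp
  have "sqrt (w x / w (x - 1)) * (w (x - 1) / w x) = sqrt (w (x - 1) / w x)"
    using pos by (simp add: real_sqrt_divide field_simps)
  then show ?thesis unfolding D by (metis mult.assoc)
qed

lemma racah_op_scaled_coeffs:
  assumes "0 < q" "q < 1" "K < 0" "racah_weight q K T S N t w"
    and x: "X + \<Delta> \<in> slice T S N t" "X + \<Delta> + 1 \<in> slice T S N t"
  shows "racah_op_scaled q K T S N t w X g (X + \<Delta>)
       = offdiag_coeff q K T S N t w X (\<Delta> + 1) * g (X + \<Delta> + 1)
         + diag_coeff q K T S N t X \<Delta> * g (X + \<Delta>)
         + offdiag_coeff q K T S N t w X \<Delta> * g (X + \<Delta> - 1)"
proof -
  have "sqrt (w (X + \<Delta> + 1) / w (X + \<Delta>)) * D_coeff q K T S N t (X + \<Delta> + 1)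
       = sqrt (w (X + \<Delta>) / w (X + \<Delta> + 1)) * B_coeff q K T S N t (X + \<Delta>)"
    using offdiag_symmetric[OF assms(1-4), of "X + \<Delta> + 1"] x by simp
  then have "offdiag_coeff q K T S N t w X (\<Delta> + 1)
      = scale_factor q T S N t X
        * (sqrt (w (X + \<Delta>) / w (X + \<Delta> + 1)) * B_coeff q K T S N t (X + \<Delta>))"
    by (simp add: offdiag_coeff_def add.assoc[symmetric] mult.assoc)
  then show ?thesis
    by (auto simp: racah_op_scaled_def racah_op_def diag_coeff_def offdiag_coeff_def algebra_simps)
qed

end

(*
  Factoring out dominant powers of q gives C D(x) = q M G(K, ...) and C B(x) = q M G(1/K, ...)
  with M = q^(m - N), C = q^(N + T + m) and one rational function
    G(k, a, b, c, e, r) = (1 - a)(1 - b)(1 - k c)(1 - k e) / ((1 - k r)(1 - k r q)),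
  where for D the last argument is r = q^(2x - S - t), and for B it is r = q^(S + t - 2x - 2).
  To the right of 2x = S + t the factor G in D tends to 1 and the one in B is negligible; to the
  left the roles are exchanged.  M may diverge, but the spectral shift contributes exactly q M to
  the diagonal, so only M (1 - G) survives, and to first order this is -k (1 + q) M r, because the
  geometry of the hexagon makes M a, M b, M c, M e vanish.  Off the diagonal,
  d = sqrt(C D(x) * C B(x - 1)), where the divergent factors cancel.
*)
theory Submission
  imports Defs
begin

section \<open>Linear growth rates of integer exponents\<close>

text \<open>The filter is a parameter so that the same rules serve \<open>at_top\<close> and its
  restriction to those L for which a border identity holds. Slope 0 leaves the limit of
  \<open>q powi e L\<close> open; such exponents are settled by exact integer identities
  instead.\<close>

definition slope :: "real filter \<Rightarrow> (real \<Rightarrow> int) \<Rightarrow> real \<Rightarrow> bool" where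
  "slope F e c \<longleftrightarrow> ((\<lambda>L. real_of_int (e L) / L) \<longlongrightarrow> c) F"

lemma slope_floor:
  assumes "F \<le> at_top"
  shows "slope F (\<lambda>L. \<lfloor>L * c\<rfloor>) c"
proof -
  have "((\<lambda>L. real_of_int \<lfloor>L * c\<rfloor> / L) \<longlongrightarrow> c) at_top"
  proof (rule tendsto_sandwich[of "\<lambda>L. c - 1 / L" _ _ "\<lambda>_. c"])
    show "\<forall>\<^sub>F L in at_top. c - 1 / L \<le> real_of_int \<lfloor>L * c\<rfloor> / L"
      using eventually_gt_at_top[of 0]
    proof eventually_elim
      case (elim L)
      have "L * c - 1 \<le> real_of_int \<lfloor>L * c\<rfloor>" by linarith
      then have "(L * c - 1) / L \<le> real_of_int \<lfloor>L * c\<rfloor> / L"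
        using elim by (intro divide_right_mono) auto
      then show ?case using elim by (simp add: diff_divide_distrib)
    qed
    show "\<forall>\<^sub>F L in at_top. real_of_int \<lfloor>L * c\<rfloor> / L \<le> c"
      using eventually_gt_at_top[of 0] by eventually_elim (simp add: field_simps)
    have "((\<lambda>L::real. 1 / L) \<longlongrightarrow> 0) at_top"
      using tendsto_inverse_0_at_top[OF filterlim_ident] by (simp add: field_simps)
    from tendsto_diff[OF tendsto_const this] show "((\<lambda>L. c - 1 / L) \<longlongrightarrow> c) at_top" by simp
  qed simp
  with assms show ?thesis unfolding slope_def by (rule tendsto_mono)
qed

lemma slope_const:
  assumes "F \<le> at_top"
  shows "slope F (\<lambda>_. j) 0"
proof -
  have "((\<lambda>L::real. real_of_int j * inverse L) \<longlongrightarrow> real_of_int j * 0) at_top"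
    by (intro tendsto_intros tendsto_inverse_0_at_top filterlim_ident)
  then show ?thesis
    unfolding slope_def using assms by (intro tendsto_mono[OF assms]) (simp add: field_simps)
qed

lemma slope_add: "slope F e c \<Longrightarrow> slope F e' c' \<Longrightarrow> slope F (\<lambda>L. e L + e' L) (c + c')"
  unfolding slope_def by (simp add: add_divide_distrib tendsto_add)

lemma slope_diff: "slope F e c \<Longrightarrow> slope F e' c' \<Longrightarrow> slope F (\<lambda>L. e L - e' L) (c - c')"
  unfolding slope_def by (simp add: diff_divide_distrib tendsto_diff)

lemma slope_mult: "slope F e c \<Longrightarrow> slope F (\<lambda>L. numeral j * e L) (numeral j * c)"
  unfolding slope_def by (simp add: tendsto_mult_left flip: times_divide_eq_right)

lemma slope_abs:
  assumes "F \<le> at_top" "slope F e c"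
  shows "slope F (\<lambda>L. \<bar>e L\<bar>) \<bar>c\<bar>"
proof -
  have "\<forall>\<^sub>F L in F. \<bar>real_of_int (e L) / L\<bar> = real_of_int \<bar>e L\<bar> / L"
    using filter_leD[OF assms(1) eventually_gt_at_top[of 0]] by eventually_elim simp
  then show ?thesis
    using tendsto_rabs[OF assms(2)[unfolded slope_def]] unfolding slope_def
    by (blast intro: Lim_transform_eventually)
qed

lemma slope_max:
  assumes "F \<le> at_top" "slope F e c" "slope F e' c'"
  shows "slope F (\<lambda>L. max (e L) (e' L)) (max c c')"
proof -
  have "\<forall>\<^sub>F L in F. max (real_of_int (e L) / L) (real_of_int (e' L) / L)
      = real_of_int (max (e L) (e' L)) / L"
    using filter_leD[OF assms(1) eventually_gt_at_top[of 0]]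
    by eventually_elim (auto simp: max_def divide_right_mono field_simps)
  then show ?thesis
    using tendsto_max[OF assms(2,3)[unfolded slope_def]] unfolding slope_def
    by (blast intro: Lim_transform_eventually)
qed

lemma slope_eventually_pos:
  assumes "F \<le> at_top" "slope F e c" "c > 0"
  shows "\<forall>\<^sub>F L in F. e L > 0"
  using order_tendstoD(1)[OF assms(2)[unfolded slope_def] assms(3)]
    filter_leD[OF assms(1) eventually_gt_at_top[of 0]]
  by eventually_elim (simp add: zero_less_divide_iff)

text \<open>Writing \<open>e L\<close> as \<open>e L / L * L\<close> shows that a positive slope
  drives it to infinity, and \<open>q powi e L\<close> is \<open>exp (ln q * e L)\<close> with
  \<open>ln q < 0\<close>.\<close>

lemma slope_powi_tendsto_0:
  fixes q :: real
  assumes "0 < q" "q < 1" "F \<le> at_top" "slope F e c" "c > 0"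
  shows "((\<lambda>L. q powi e L) \<longlongrightarrow> 0) F"
proof -
  have "filterlim (\<lambda>L. real_of_int (e L) / L * L) at_top F"
    using filterlim_tendsto_pos_mult_at_top[OF assms(4)[unfolded slope_def] assms(5)]
      filterlim_mono[OF filterlim_ident order_refl assms(3)] by blast
  moreover have "\<forall>\<^sub>F L in F. real_of_int (e L) / L * L = real_of_int (e L)"
    using filter_leD[OF assms(3) eventually_gt_at_top[of 0]] by eventually_elim simp
  ultimately have e: "filterlim (\<lambda>L. real_of_int (e L)) at_top F"
    by (rule filterlim_cong[OF refl refl, THEN iffD1, rotated])
  have "ln q < 0" using assms by simp
  then have "filterlim (\<lambda>L. ln q * real_of_int (e L)) at_bot F"
    using filterlim_tendsto_neg_mult_at_bot[OF tendsto_const _ e] by blast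
  then have "((\<lambda>L. exp (ln q * real_of_int (e L))) \<longlongrightarrow> 0) F"
    by (rule filterlim_compose[OF exp_at_bot])
  moreover have "exp (ln q * real_of_int (e L)) = q powi e L" for L
    using assms(1) by (simp add: powr_def mult.commute flip: powr_real_of_int')
  ultimately show ?thesis by simp
qed

section \<open>The rational factor and its asymptotic regimes\<close>

definition racah_quot :: "real \<Rightarrow> real \<Rightarrow> real \<Rightarrow> real \<Rightarrow> real \<Rightarrow> real \<Rightarrow> real \<Rightarrow> real" where
  "racah_quot q k a b c e r =
     (1 - a) * (1 - b) * (1 - k * c) * (1 - k * e) / ((1 - k * r) * (1 - k * r * q))"

text \<open>The regime of convergent \<open>r\<close>. With \<rho> = 0 the limit is 1; with \<rho> >
  0 it describes the axis 2x' = S' + t', where the factors of B and D both survive.\<close>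

lemma racah_quot_tendsto:
  assumes "(a \<longlongrightarrow> 0) F" "(b \<longlongrightarrow> 0) F" "(c \<longlongrightarrow> 0) F" "(e \<longlongrightarrow> 0) F" "(r \<longlongrightarrow> \<rho>) F"
    and "1 - k * \<rho> \<noteq> 0" "1 - k * \<rho> * q \<noteq> 0"
  shows "((\<lambda>L. racah_quot q k (a L) (b L) (c L) (e L) (r L))
    \<longlongrightarrow> 1 / ((1 - k * \<rho>) * (1 - k * \<rho> * q))) F"
proof -
  have "((\<lambda>L. racah_quot q k (a L) (b L) (c L) (e L) (r L)) \<longlongrightarrow>
     (1 - 0) * (1 - 0) * (1 - k * 0) * (1 - k * 0) / ((1 - k * \<rho>) * (1 - k * \<rho> * q))) F"
    unfolding racah_quot_def by (intro tendsto_intros assms) (use assms in auto)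
  then show ?thesis by simp
qed

text \<open>The multiplier \<open>M\<close> may diverge, so every summand of the defect has to be
  controlled after multiplication by \<open>M\<close>. To first order the denominator is 1 - k (1 +
  q) r, and only this term reaches the limit.\<close>

lemma racah_quot_defect_tendsto:
  assumes "(a \<longlongrightarrow> 0) F" "(b \<longlongrightarrow> 0) F" "(c \<longlongrightarrow> 0) F" "(e \<longlongrightarrow> 0) F" "(r \<longlongrightarrow> 0) F"
    and "((\<lambda>L. M L * a L) \<longlongrightarrow> 0) F" "((\<lambda>L. M L * b L) \<longlongrightarrow> 0) F"
      "((\<lambda>L. M L * c L) \<longlongrightarrow> 0) F" "((\<lambda>L. M L * e L) \<longlongrightarrow> 0) F"
      "((\<lambda>L. M L * r L) \<longlongrightarrow> \<rho>) F"
    and "\<And>L. 1 - k * r L \<noteq> 0" "\<And>L. 1 - k * r L * q \<noteq> 0"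
  shows "((\<lambda>L. M L * (1 - racah_quot q k (a L) (b L) (c L) (e L) (r L)))
    \<longlongrightarrow> - k * \<rho> * (1 + q)) F"
proof -
  \<comment> \<open>The numerator is telescoped: each of the four factors of the product is split
    off in turn, so that each summand carries exactly one of \<open>a\<close>, \<open>b\<close>,
    \<open>c\<close>, \<open>e\<close> next to \<open>M\<close>. The last summand is the denominator
    minus 1.\<close>
  have eq: "M L * (1 - racah_quot q k (a L) (b L) (c L) (e L) (r L)) =
     (M L * a L + M L * b L * (1 - a L) + k * (M L * c L) * (1 - a L) * (1 - b L)
       + k * (M L * e L) * (1 - a L) * (1 - b L) * (1 - k * c L)
       - k * (M L * r L) * (1 + q - k * r L * q)) / ((1 - k * r L) * (1 - k * r L * q))" for L
    using assms(11,12)[of L] unfolding racah_quot_def by (simp add: divide_simps) algebra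
  have "((\<lambda>L. M L * (1 - racah_quot q k (a L) (b L) (c L) (e L) (r L))) \<longlongrightarrow>
     (0 + 0 * (1 - 0) + k * 0 * (1 - 0) * (1 - 0)
       + k * 0 * (1 - 0) * (1 - 0) * (1 - k * 0)
       - k * \<rho> * (1 + q - k * 0 * q)) / ((1 - k * 0) * (1 - k * 0 * q))) F"
    unfolding eq by (intro tendsto_intros assms) auto
  then show ?thesis by simp
qed

text \<open>The regime in which \<open>r = 1 / s\<close> diverges. The denominator grows like
  \<open>k^2 * q / s^2\<close>, so the multiplier \<open>W\<close> enters only through
  \<open>W * s^2\<close>. Since \<open>c\<close> and \<open>e\<close> may diverge as well, it is
  their products with \<open>W * s^2\<close> that are controlled. \<open>W\<close> will be the first
  power of \<open>q powi M\<close> on the diagonal and the second power off it.\<close>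

lemma racah_quot_large_tendsto:
  assumes "(a \<longlongrightarrow> 0) F" "(b \<longlongrightarrow> 0) F" "(s \<longlongrightarrow> 0) F"
    and "((\<lambda>L. W L * s L ^ 2) \<longlongrightarrow> \<sigma>) F" "((\<lambda>L. W L * s L ^ 2 * c L) \<longlongrightarrow> 0) F"
      "((\<lambda>L. W L * s L ^ 2 * e L) \<longlongrightarrow> 0) F" "((\<lambda>L. W L * s L ^ 2 * c L * e L) \<longlongrightarrow> 0) F"
    and "\<And>L. s L > 0" "k < 0" "q > 0"
  shows "((\<lambda>L. W L * racah_quot q k (a L) (b L) (c L) (e L) (inverse (s L)))
    \<longlongrightarrow> \<sigma> / (k\<^sup>2 * q)) F"
proof -
  have "k * q < 0" using assms by (simp add: mult_neg_pos)
  then have nz: "s L - k \<noteq> 0" "s L - k * q \<noteq> 0" "s L \<noteq> 0" for L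
    using assms(8)[of L] assms(9) by auto
  have d: "(1 - k * inverse (s L)) * (1 - k * inverse (s L) * q)
      = (s L - k) * (s L - k * q) / s L ^ 2" for L
    using nz[of L] by (simp add: field_simps power2_eq_square)
  have eq: "W L * racah_quot q k (a L) (b L) (c L) (e L) (inverse (s L)) =
     (1 - a L) * (1 - b L) * (W L * s L ^ 2 - k * (W L * s L ^ 2 * c L)
        - k * (W L * s L ^ 2 * e L) + k^2 * (W L * s L ^ 2 * c L * e L))
     / ((s L - k) * (s L - k * q))" for L
    using nz[of L] unfolding racah_quot_def d
    by (simp add: divide_simps) (simp add: algebra_simps power2_eq_square)
  have "((\<lambda>L. W L * racah_quot q k (a L) (b L) (c L) (e L) (inverse (s L))) \<longlongrightarrow>
     (1 - 0) * (1 - 0) * (\<sigma> - k * 0 - k * 0 + k^2 * 0) / ((0 - k) * (0 - k * q))) F"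
    unfolding eq by (intro tendsto_intros assms) (use assms in auto)
  then show ?thesis by (simp add: power2_eq_square mult.assoc)
qed

section \<open>Factorization of the scaled coefficients\<close>

definition scale_exp :: "int \<Rightarrow> int \<Rightarrow> int \<Rightarrow> int \<Rightarrow> int" where
  "scale_exp S N t X = max (N - \<bar>2 * X - S - t\<bar>) 0"

text \<open>The last argument comes from the denominator factor of \<open>B_coeff\<close> with
  exponent 2x + 2; the one with 2x + 1 then becomes 1 - k r q. This explains the offset -2, which
  \<open>D_quot\<close>, with exponents 2x and 2x + 1, does not have.\<close>

definition B_quot :: "real \<Rightarrow> real \<Rightarrow> int \<Rightarrow> int \<Rightarrow> int \<Rightarrow> int \<Rightarrow> int \<Rightarrow> real" where
  "B_quot q K T S N t x = racah_quot q (inverse K) (q powi (N + S - x - 1)) (q powi (N + t - x - 1))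
     (q powi (T - x - 1)) (q powi (S + t - x - 1)) (q powi (S + t - 2 * x - 2))"

definition D_quot :: "real \<Rightarrow> real \<Rightarrow> int \<Rightarrow> int \<Rightarrow> int \<Rightarrow> int \<Rightarrow> int \<Rightarrow> real" where
  "D_quot q K T S N t x = racah_quot q K (q powi x) (q powi (T + x - S - t))
     (q powi (N + x - S)) (q powi (N + x - t)) (q powi (2 * x - S - t))"

text \<open>The numerator releases the powers of q with exponents S, t and S + t, which cancel the
  two powers \<open>q powi (S + t)\<close> taken out of the denominator.\<close>

lemma scaled_D:
  assumes "0 < q" "K < 0"
  shows "scale_factor q T S N t X * D_coeff q K T S N t x
    = q * q powi (scale_exp S N t X - N) * D_quot q K T S N t x"
proof -
  have p: "q powi a - K * q powi b \<noteq> 0" for a b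
    using racah_denominator_pos[OF assms, of a b] by simp
  have q: "q \<noteq> 0" "q powi a \<noteq> 0" for a using assms by auto
  have "1 - K * q powi (2 * x - S - t) \<noteq> 0" "1 - K * q powi (2 * x - S - t) * q \<noteq> 0"
    using p[of 0 "2 * x - S - t"] p[of 0 "2 * x - S - t + 1"] q by (auto simp: power_int_add_1 mult.assoc)
  note nz = this p[of "S + t" "2 * x"] p[of "S + t" "2 * x + 1"]
  have q1: "q powi (2 * x + 1) = q powi (2*x) * q" using q by (simp add: power_int_add_1)
  have d1: "q powi (S + t) - K * q powi (2 * x) = q powi (S + t) * (1 - K * q powi (2 * x - S - t))"
    and d2: "q powi (S + t) - K * q powi (2 * x + 1) = q powi (S + t) * (1 - K * q powi (2 * x - S - t) * q)"
    and n1: "q powi S - K * q powi (N + x) = q powi S * (1 - K * q powi (N + x - S))"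
    and n2: "q powi t - K * q powi (N + x) = q powi t * (1 - K * q powi (N + x - t))"
    and n3: "q powi (S + t) - q powi (T + x) = q powi (S + t) * (1 - q powi (T + x - S - t))"
    using q by (simp_all add: algebra_simps power_int_add power_int_diff)
  have c: "q powi (N + T + max (N - \<bar>2 * X - S - t\<bar>) 0) * q powi (- 2 * N - T + 1)
      = q * q powi (scale_exp S N t X - N)"
    using q unfolding scale_exp_def
    by (simp flip: power_int_add power_int_add_1' add: algebra_simps)
  have st: "q powi S * q powi t = q powi (S + t)" using q by (simp add: power_int_add)
  have "scale_factor q T S N t X * D_coeff q K T S N t x =
    (q powi (N + T + max (N - \<bar>2 * X - S - t\<bar>) 0) * q powi (- 2 * N - T + 1)) *
    ((1 - q powi x) * (1 - K * q powi (N + x - S)) * (1 - K * q powi (N + x - t)) * (1 - q powi (T + x - S - t))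
     * ((q powi S * q powi t) * q powi (S + t))
     / (q powi (S + t) * q powi (S + t) * ((1 - K * q powi (2 * x - S - t)) * (1 - K * q powi (2 * x - S - t) * q))))"
    unfolding scale_factor_def D_coeff_def d1 d2 n1 n2 n3 by (simp add: mult_ac)
  also have "\<dots> = q * q powi (scale_exp S N t X - N) * D_quot q K T S N t x"
    unfolding c st D_quot_def racah_quot_def using q nz by (simp add: mult_ac)
  finally show ?thesis .
qed

text \<open>Here the terms containing K or \<open>q powi (x + 1)\<close> are taken out instead,
  which puts \<open>inverse K\<close> in the place of K. All signs and powers of K cancel.\<close>

lemma scaled_B:
  assumes "0 < q" "K < 0"
  shows "scale_factor q T S N t X * B_coeff q K T S N t x
    = q * q powi (scale_exp S N t X - N) * B_quot q K T S N t x"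
proof -
  have q: "q \<noteq> 0" "q powi a \<noteq> 0" for a using assms by auto
  have K: "K \<noteq> 0" using assms by simp
  have d1: "q powi (S + t) - K * q powi (2 * x + 2)
      = - K * q powi (2 * x + 2) * (1 - inverse K * q powi (S + t - 2 * x - 2))"
    and d2: "q powi (S + t) - K * q powi (2 * x + 1)
      = - K * q powi (2 * x + 1) * (1 - inverse K * q powi (S + t - 2 * x - 2) * q)"
    and n1: "q powi T - K * q powi (x + 1) = - K * q powi (x + 1) * (1 - inverse K * q powi (T - x - 1))"
    and n2: "q powi (S + t) - K * q powi (x + 1) = - K * q powi (x + 1) * (1 - inverse K * q powi (S + t - x - 1))"
    and n3: "q powi (N + S) - q powi (x + 1) = - (q powi (x + 1)) * (1 - q powi (N + S - x - 1))"
    and n4: "q powi (N + t) - q powi (x + 1) = - (q powi (x + 1)) * (1 - q powi (N + t - x - 1))"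
    using q K by (simp_all add: field_simps power_int_add power_int_diff power2_eq_square)
  have c: "q powi (N + T + max (N - \<bar>2 * X - S - t\<bar>) 0) * q powi (- 2 * N - T)
      = q powi (scale_exp S N t X - N)"
    using q unfolding scale_exp_def by (simp flip: power_int_add add: algebra_simps)
  \<comment> \<open>Since 4(x + 1) = 1 + (2x + 1) + (2x + 2), one factor q is left over; it makes
    the prefactor agree with the one in \<open>scaled_D\<close>.\<close>
  have x4: "q powi (x + 1) * q powi (x + 1) * q powi (x + 1) * q powi (x + 1)
      = q * (q powi (2 * x + 1) * q powi (2 * x + 2))"
    using q by (simp flip: power_int_add power_int_add_1' add: algebra_simps)
  have gen: "C * (Q * (- K * u * a) * (- u * b) * (- u * c) * (- K * u * e) / ((- K * v * f) * (- K * w * g)))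
     = C * Q * (u * u * u * u) / (v * w) * (b * c * a * e / (g * f))" for C Q a b c e f g u v w :: real
    using K by (simp add: divide_simps)
  show ?thesis
    unfolding scale_factor_def B_coeff_def d1 d2 n1 n2 n3 n4 gen c x4 B_quot_def racah_quot_def
    using q by simp
qed

text \<open>In the code \<open>M\<close> denotes the exponent m - N. Besides
  \<open>q * q powi M\<close>, the expanded shift leaves \<open>q powi m\<close> times -1 plus two
  powers that will vanish. This is the source of the summand -1 in the cases where m is eventually
  0.\<close>

lemma diag_coeff_quot:
  fixes S N t X :: int
  assumes "0 < q" "K < 0"
  defines "M \<equiv> scale_exp S N t X - N"
  shows "diag_coeff q K T S N t X \<Delta> =
    q powi scale_exp S N t X * (q powi (N + T) - q powi (T + 1) - 1)
    + q * q powi M * (1 - B_quot q K T S N t (X + \<Delta>) - D_quot q K T S N t (X + \<Delta>))"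
proof -
  have q: "q \<noteq> 0" "q powi a \<noteq> 0" for a using assms by auto
  have "scale_factor q T S N t X * spectral_shift q T N
      = q powi scale_exp S N t X * (q powi (N + T) - q powi (T + 1) - 1) + q * q powi M"
    unfolding scale_factor_def spectral_shift_def M_def scale_exp_def[symmetric]
    using q by (simp add: field_simps power_int_add power_int_diff power_int_minus)
  then show ?thesis
    unfolding diag_coeff_def right_diff_distrib scaled_B[OF assms(1,2)] scaled_D[OF assms(1,2)] M_def
    by (simp add: algebra_simps)
qed

text \<open>
  The recurrence \<open>D(x) = w(x-1)/w(x) B(x-1)\<close> turns the weights into the geometric mean of
  \<open>C D(x)\<close> and \<open>C B(x-1)\<close>.
\<close>

lemma offdiag_coeff_quot:
  fixes S N t X \<Delta> :: int
  assumes q: "0 < q" "q < 1" and K: "K < 0" and w: "racah_weight q K T S N t w"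
    and x: "X + \<Delta> \<in> slice T S N t" "X + \<Delta> - 1 \<in> slice T S N t"
  defines "M \<equiv> scale_exp S N t X - N"
  shows "offdiag_coeff q K T S N t w X \<Delta> =
    sqrt (q\<^sup>2 * ((q powi M)\<^sup>2 * B_quot q K T S N t (X + \<Delta> - 1) * D_quot q K T S N t (X + \<Delta>)))"
proof -
  let ?x = "X + \<Delta>"
  let ?B = "B_coeff q K T S N t (?x - 1)" and ?D = "D_coeff q K T S N t ?x"
    and ?C = "scale_factor q T S N t X"
  have pos: "w ?x > 0" "w (?x - 1) > 0" using w x by (auto simp: racah_weight_def)
  note p = racah_denominator_pos[OF q(1) K] and s = racah_signs[OF q, of "?x - 1" T S N t]
  \<comment> \<open>On the slice the two factors of \<open>B_coeff\<close> with
    \<open>q powi (N + S)\<close> and \<open>q powi (N + t)\<close> are both negative.\<close>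
  have pn: "0 < a * b * c" if "a > 0" "b < 0" "c < 0" for a b c :: real
    using that by (simp add: mult_pos_neg mult_neg_neg)
  have B: "?B > 0" unfolding B_coeff_def
    using q s x by (intro divide_pos_pos mult_pos_pos pn p) auto
  have C: "?C > 0" unfolding scale_factor_def using q by simp
  have "w (?x - 1) / w (?x - 1 + 1) = racah_ratio q K T S N t (?x - 1)"
    using w x unfolding racah_weight_def by (metis diff_add_cancel)
  then have D: "?D = w (?x - 1) / w ?x * ?B"
    using racah_ratio_D_B[OF q K, of "?x - 1" T S N t] x by simp
  have "offdiag_coeff q K T S N t w X \<Delta> = ?C * (sqrt (w (?x - 1) / w ?x) * ?B)"
    unfolding offdiag_coeff_def using offdiag_symmetric[OF q K w x] by (simp add: mult.assoc)
  \<comment> \<open>Positivity of \<open>?C\<close> and \<open>?B\<close> allows the passage to the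
    root of the square, where one factor \<open>?B\<close> absorbs the ratio of weights and becomes
    \<open>?D\<close>.\<close>
  also have "\<dots> = sqrt ((?C * (sqrt (w (?x - 1) / w ?x) * ?B))\<^sup>2)"
    using B C pos by (subst real_sqrt_abs) (simp add: abs_mult)
  also have "(?C * (sqrt (w (?x - 1) / w ?x) * ?B))\<^sup>2 = (?C * ?B) * (?C * ?D)"
    unfolding D using pos by (simp add: power_mult_distrib power2_eq_square mult_ac)
  also have "\<dots> = q\<^sup>2 * ((q powi M)\<^sup>2 * B_quot q K T S N t (?x - 1) * D_quot q K T S N t ?x)"
    unfolding scaled_B[OF q(1) K] scaled_D[OF q(1) K] M_def by (simp add: power2_eq_square mult_ac)
  finally show ?thesis .
qed

text \<open>The last argument is displayed as the reciprocal of a power that tends to 0 on the right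
  of the axis, as \<open>racah_quot_large_tendsto\<close> expects. The analogous form of
  \<open>D_quot\<close> serves the left.\<close>

lemma B_quot_inverse: "B_quot q K T S N t x =
   racah_quot q (inverse K) (q powi (N + S - x - 1)) (q powi (N + t - x - 1))
     (q powi (T - x - 1)) (q powi (S + t - x - 1)) (inverse (q powi (2 * x + 2 - S - t)))"
  unfolding B_quot_def by (simp flip: power_int_minus add: algebra_simps)

lemma D_quot_inverse: "D_quot q K T S N t x =
   racah_quot q K (q powi x) (q powi (T + x - S - t))
     (q powi (N + x - S)) (q powi (N + x - t)) (inverse (q powi (S + t - 2 * x)))"
  unfolding D_quot_def by (simp flip: power_int_minus add: algebra_simps)

section \<open>The limiting regime and its exponents\<close>

text \<open>\<open>triangle\<close> spells out the bounds by \<open>t_left\<close> and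
  \<open>t_right\<close>, and \<open>hex\<close> the bounds on x', as linear inequalities ready for
  \<open>linarith\<close>. One interpretation per filter covers all six cases.\<close>

locale racah_limit =
  fixes q K T' S' N' t' x' :: real and T S N t X :: "real \<Rightarrow> int"
    and w :: "real \<Rightarrow> int \<Rightarrow> real" and \<Delta> :: int and F :: "real filter"
  assumes q: "0 < q" "q < 1" and K: "K < 0" and F: "F \<le> at_top"
    and pos: "0 < S'" "0 < N'" "S' < T'" "N' < T'"
    and triangle: "N' - S' < t'" "S' - N' < t'" "t' < N' + S'" "t' < 2 * T' - N' - S'"
    and hex: "0 < x'" "t' - T' + S' < x'" "x' < S' + N'" "x' < t' + N'"
    and floors: "T = (\<lambda>L. \<lfloor>L * T'\<rfloor>)" "S = (\<lambda>L. \<lfloor>L * S'\<rfloor>)" "N = (\<lambda>L. \<lfloor>L * N'\<rfloor>)"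
      "t = (\<lambda>L. \<lfloor>L * t'\<rfloor>)" "X = (\<lambda>L. \<lfloor>L * x'\<rfloor>)"
    and w: "\<And>L. L > 0 \<Longrightarrow> racah_weight q K (T L) (S L) (N L) (t L) (w L)"
begin

abbreviation "m L \<equiv> scale_exp (S L) (N L) (t L) (X L)"
abbreviation "M L \<equiv> m L - N L"
abbreviation "x L \<equiv> X L + \<Delta>"
abbreviation "a L \<equiv> diag_coeff q K (T L) (S L) (N L) (t L) (X L) \<Delta>"
abbreviation "d L \<equiv> offdiag_coeff q K (T L) (S L) (N L) (t L) (w L) (X L) \<Delta>"
abbreviation "GB L y \<equiv> B_quot q K (T L) (S L) (N L) (t L) y"
abbreviation "GD L y \<equiv> D_quot q K (T L) (S L) (N L) (t L) y"

lemma slope_params: "slope F T T'" "slope F S S'" "slope F N N'" "slope F t t'" "slope F X x'"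
  unfolding floors by (rule slope_floor[OF F])+

text \<open>Repeated application of these rules computes the slope of an exponent from its syntax;
  what remains is a linear inequality between the macroscopic parameters.\<close>

lemmas slopes = slope_params slope_add slope_diff slope_mult
  slope_abs[OF F] slope_max[OF F] slope_const[OF F]

lemma slope_m: "slope F m (max (N' - \<bar>2 * x' - S' - t'\<bar>) 0)"
  unfolding scale_exp_def by (rule slopes)+

lemmas powi_tendsto_0 = slope_powi_tendsto_0[OF q F]

lemma powi_mult: "q powi i * q powi j = q powi (i + j)"
  using q by (simp add: power_int_add)

lemma denom: "1 - K * q powi i \<noteq> 0" "1 - K * q powi i * q \<noteq> 0"
   "1 - inverse K * q powi i \<noteq> 0" "1 - inverse K * q powi i * q \<noteq> 0"
proof -
  have "K * q powi i < 0" "K * q powi i * q < 0"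
    "inverse K * q powi i < 0" "inverse K * q powi i * q < 0"
    using q K by (simp_all add: mult_neg_pos)
  then show "1 - K * q powi i \<noteq> 0" "1 - K * q powi i * q \<noteq> 0"
   "1 - inverse K * q powi i \<noteq> 0" "1 - inverse K * q powi i * q \<noteq> 0" by linarith+
qed

text \<open>The strict inequalities of the hexagon leave a margin that grows linearly in L and
  absorbs the fixed offsets \<Delta> and -1.\<close>

lemma eventually_slice:
  "\<forall>\<^sub>F L in F. x L \<in> slice (T L) (S L) (N L) (t L)
    \<and> x L - 1 \<in> slice (T L) (S L) (N L) (t L)"
proof -
  have "\<forall>\<^sub>F L in F. x L > 0"
    by (rule slope_eventually_pos[OF F], (rule slopes)+) (use hex in linarith)
  moreover have "\<forall>\<^sub>F L in F. x L - (t L + S L - T L) > 0"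
    by (rule slope_eventually_pos[OF F], (rule slopes)+) (use hex in linarith)
  moreover have "\<forall>\<^sub>F L in F. t L + N L - x L > 0"
    by (rule slope_eventually_pos[OF F], (rule slopes)+) (use hex in linarith)
  moreover have "\<forall>\<^sub>F L in F. S L + N L - x L > 0"
    by (rule slope_eventually_pos[OF F], (rule slopes)+) (use hex in linarith)
  ultimately show ?thesis by eventually_elim (auto simp: slice_def)
qed

text \<open>The weights are governed by the recurrence only inside the slice, so the root formula
  for \<open>d\<close> holds only eventually. The sign of \<open>v\<close> selects the root.\<close>

lemma offdiag_tendsto:
  assumes "((\<lambda>L. (q powi M L)\<^sup>2 * GB L (x L - 1) * GD L (x L)) \<longlongrightarrow> c) F"
    and "q\<^sup>2 * c = v\<^sup>2" "v \<ge> 0"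
  shows "(d \<longlongrightarrow> v) F"
proof -
  have "\<forall>\<^sub>F L in F. sqrt (q\<^sup>2 * ((q powi M L)\<^sup>2 * GB L (x L - 1) * GD L (x L))) = d L"
    using eventually_slice filter_leD[OF F eventually_gt_at_top[of 0]]
    by eventually_elim (rule offdiag_coeff_quot[symmetric], auto intro: q K w)
  moreover have "((\<lambda>L. sqrt (q\<^sup>2 * ((q powi M L)\<^sup>2 * GB L (x L - 1) * GD L (x L)))) \<longlongrightarrow> sqrt (q\<^sup>2 * c)) F"
    by (intro tendsto_real_sqrt tendsto_mult_left assms)
  moreover have "sqrt (q\<^sup>2 * c) = v" unfolding assms(2) using assms(3) by simp
  ultimately show ?thesis using Lim_transform_eventually by fastforce
qed

lemma diag_tendsto:
  assumes "((\<lambda>L. q powi m L) \<longlongrightarrow> \<mu>) F"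
    and "((\<lambda>L. q powi M L * (1 - GB L (x L) - GD L (x L))) \<longlongrightarrow> v) F"
  shows "(a \<longlongrightarrow> - \<mu> + q * v) F"
proof -
  have 1: "((\<lambda>L. q powi (N L + T L)) \<longlongrightarrow> 0) F"
    by (rule powi_tendsto_0, (rule slopes)+) (use pos in linarith)
  have 2: "((\<lambda>L. q powi (T L + 1)) \<longlongrightarrow> 0) F"
    by (rule powi_tendsto_0, (rule slopes)+) (use pos in linarith)
  have "(a \<longlongrightarrow> \<mu> * (0 - 0 - 1) + q * v) F"
    unfolding diag_coeff_quot[OF q(1) K] mult.assoc by (intro tendsto_intros assms 1 2)
  then show ?thesis by simp
qed

section \<open>Limits on either side of the axis 2x' = S' + t'\<close>

text \<open>Everything on this side depends on two numbers: \<mu>, which is 1 on and beyond the edge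
  and 0 inside, and \<rho>, the limit of \<open>q powi M * r\<close>, which is 0 beyond the edge and
  \<open>q powi (2 * \<Delta>)\<close> otherwise.\<close>

lemma right_limits:
  assumes right: "S' + t' < 2 * x'" and \<rho>: "\<rho> \<ge> 0"
    and M\<rho>: "((\<lambda>L. q powi (M L + (2 * x L - S L - t L))) \<longlongrightarrow> \<rho>) F"
    and \<mu>: "((\<lambda>L. q powi m L) \<longlongrightarrow> \<mu>) F"
  shows "(a \<longlongrightarrow> - \<mu> - K * (1 + q) * q * \<rho>) F" "(d \<longlongrightarrow> - K * \<rho> * sqrt q) F"
proof -
  \<comment> \<open>\<open>M L \<sim> - \<nu> L\<close>, so \<open>q powi M L * q powi e L\<close> vanishes once \<open>e\<close> has slope above \<open>\<nu>\<close>.\<close>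
  define \<nu> where "\<nu> = min N' (2 * x' - S' - t')"
  have \<nu>: "0 < \<nu>" "\<nu> \<le> N'" "\<nu> \<le> 2 * x' - S' - t'"
    using right pos by (auto simp: \<nu>_def)
  have "max (N' - \<bar>2 * x' - S' - t'\<bar>) 0 - N' = - \<nu>"
    using right by (auto simp: \<nu>_def)
  with slope_diff[OF slope_m slope_params(3)] have sM: "slope F M (- \<nu>)" by simp
  note sl = sM slopes
  \<comment> \<open>Averaging the two upper bounds gives \<nu> \<le> (N' + 2x' - S' - t') / 2, which
    eliminates x' from the slopes belonging to M a, M b, M c, M e. What remains as lower bounds are
    the halves of S' + t' - N', 2T' - S' - N' - t', N' + t' - S' and N' + S' - t', all positive by
    \<open>triangle\<close>.\<close>
  have defect: "((\<lambda>L. q powi M L * (1 - GD L (x L))) \<longlongrightarrow> - K * \<rho> * (1 + q)) F"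
    unfolding D_quot_def
    by (rule racah_quot_defect_tendsto;
        (unfold powi_mult)?; (rule M\<rho> denom | (rule powi_tendsto_0, (rule sl)+)))
      (simp only: add_0_right diff_zero, use \<nu> hex triangle pos in linarith)+
  have GD: "((\<lambda>L. GD L (x L)) \<longlongrightarrow> 1 / ((1 - K * 0) * (1 - K * 0 * q))) F"
    unfolding D_quot_def
    by (rule racah_quot_tendsto; ((rule powi_tendsto_0, (rule sl)+) | simp))
      (simp only: add_0_right diff_zero, use \<nu> hex triangle pos in linarith)+
  \<comment> \<open>With a single factor \<open>q powi M\<close> the decay of B wins: the exponent
    has slope at least -\<nu> + 2\<nu>.\<close>
  have GB: "((\<lambda>L. q powi M L * GB L (x L)) \<longlongrightarrow> 0 / ((inverse K)\<^sup>2 * q)) F"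
    unfolding B_quot_inverse
    by (rule racah_quot_large_tendsto;
        (rule K q)?; (unfold powi_mult power2_eq_square)?; ((rule powi_tendsto_0, (rule sl)+) | simp add: q K))
      (simp only: add_0_right diff_zero, use \<nu> hex triangle pos in linarith)+
  \<comment> \<open>At \<open>x L - 1\<close> the offset of B disappears, 2(x - 1) + 2 = 2x, so the
    second power of \<open>q powi M\<close> balances the decay of B exactly.\<close>
  have sq: "((\<lambda>L. (q powi M L)\<^sup>2 * (q powi (2 * (x L - 1) + 2 - S L - t L))\<^sup>2) \<longlongrightarrow> \<rho>\<^sup>2) F"
    using tendsto_power[OF M\<rho>, of 2]
    unfolding power_mult_distrib[symmetric] powi_mult by (simp add: algebra_simps)
  have GB': "((\<lambda>L. (q powi M L)\<^sup>2 * GB L (x L - 1)) \<longlongrightarrow> \<rho>\<^sup>2 / ((inverse K)\<^sup>2 * q)) F"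
    unfolding B_quot_inverse
    by (rule racah_quot_large_tendsto;
        (rule sq K q)?; (unfold powi_mult power2_eq_square)?; ((rule powi_tendsto_0, (rule sl)+) | simp add: q K))
      (simp only: add_0_right diff_zero, use \<nu> hex triangle pos in linarith)+
  have "((\<lambda>L. q powi M L * (1 - GB L (x L) - GD L (x L))) \<longlongrightarrow> - K * \<rho> * (1 + q)) F"
    using tendsto_diff[OF defect GB] by (simp add: algebra_simps)
  from diag_tendsto[OF \<mu> this] show "(a \<longlongrightarrow> - \<mu> - K * (1 + q) * q * \<rho>) F"
    by (simp add: algebra_simps)
  show "(d \<longlongrightarrow> - K * \<rho> * sqrt q) F"
    by (rule offdiag_tendsto[OF tendsto_mult[OF GB' GD]])
      (use q K \<rho> in \<open>auto simp: field_simps power2_eq_square mult_nonpos_nonneg\<close>)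
qed

text \<open>B and D exchange roles and K becomes \<open>inverse K\<close>. On the diagonal the
  offset -2 in B contributes \<open>q powi (-2)\<close>, which turns the factor q of the right side
  into 1 / q; off the diagonal B is taken at x - 1 and the offset cancels.\<close>

lemma left_limits:
  assumes left: "2 * x' < S' + t'" and \<rho>: "\<rho> \<ge> 0"
    and M\<rho>: "((\<lambda>L. q powi (M L + (S L + t L - 2 * x L))) \<longlongrightarrow> \<rho>) F"
    and \<mu>: "((\<lambda>L. q powi m L) \<longlongrightarrow> \<mu>) F"
  shows "(a \<longlongrightarrow> - \<mu> - inverse K * (1 + q) * \<rho> / q) F" "(d \<longlongrightarrow> - inverse K * \<rho> * sqrt q) F"
proof -
  define \<nu> where "\<nu> = min N' (S' + t' - 2 * x')"
  have \<nu>: "0 < \<nu>" "\<nu> \<le> N'" "\<nu> \<le> S' + t' - 2 * x'"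
    using left pos by (auto simp: \<nu>_def)
  have "max (N' - \<bar>2 * x' - S' - t'\<bar>) 0 - N' = - \<nu>"
    using left by (auto simp: \<nu>_def)
  with slope_diff[OF slope_m slope_params(3)] have sM: "slope F M (- \<nu>)" by simp
  note sl = sM slopes
  have "((\<lambda>L. q powi (M L + (S L + t L - 2 * x L)) * q powi (-2)) \<longlongrightarrow> \<rho> * q powi (-2)) F"
    by (intro tendsto_intros M\<rho>)
  then have M\<rho>': "((\<lambda>L. q powi (M L + (S L + t L - 2 * x L - 2))) \<longlongrightarrow> \<rho> * q powi (-2)) F"
    unfolding powi_mult by (simp add: algebra_simps)
  have defect: "((\<lambda>L. q powi M L * (1 - GB L (x L))) \<longlongrightarrow> - inverse K * (\<rho> * q powi (-2)) * (1 + q)) F"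
    unfolding B_quot_def
    by (rule racah_quot_defect_tendsto;
        (unfold powi_mult)?; (rule M\<rho>' denom | (rule powi_tendsto_0, (rule sl)+)))
      (simp only: add_0_right diff_zero, use \<nu> hex triangle pos in linarith)+
  have GB: "((\<lambda>L. GB L (x L - 1)) \<longlongrightarrow> 1 / ((1 - inverse K * 0) * (1 - inverse K * 0 * q))) F"
    unfolding B_quot_def
    by (rule racah_quot_tendsto; ((rule powi_tendsto_0, (rule sl)+) | simp))
      (simp only: add_0_right diff_zero, use \<nu> hex triangle pos in linarith)+
  have GD: "((\<lambda>L. q powi M L * GD L (x L)) \<longlongrightarrow> 0 / (K\<^sup>2 * q)) F"
    unfolding D_quot_inverse
    by (rule racah_quot_large_tendsto;
        (rule K q)?; (unfold powi_mult power2_eq_square)?; ((rule powi_tendsto_0, (rule sl)+) | simp add: q K))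
      (simp only: add_0_right diff_zero, use \<nu> hex triangle pos in linarith)+
  have sq: "((\<lambda>L. (q powi M L)\<^sup>2 * (q powi (S L + t L - 2 * x L))\<^sup>2) \<longlongrightarrow> \<rho>\<^sup>2) F"
    using tendsto_power[OF M\<rho>, of 2]
    unfolding power_mult_distrib[symmetric] powi_mult by (simp add: algebra_simps)
  have GD': "((\<lambda>L. (q powi M L)\<^sup>2 * GD L (x L)) \<longlongrightarrow> \<rho>\<^sup>2 / (K\<^sup>2 * q)) F"
    unfolding D_quot_inverse
    by (rule racah_quot_large_tendsto;
        (rule sq K q)?; (unfold powi_mult power2_eq_square)?; ((rule powi_tendsto_0, (rule sl)+) | simp add: q K))
      (simp only: add_0_right diff_zero, use \<nu> hex triangle pos in linarith)+
  have v: "((\<lambda>L. q powi M L * (1 - GB L (x L) - GD L (x L))) \<longlongrightarrow> - inverse K * (\<rho> * q powi (-2)) * (1 + q)) F"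
    using tendsto_diff[OF defect GD] by (simp add: algebra_simps)
  have eq: "- \<mu> + q * (- inverse K * (\<rho> * q powi (-2)) * (1 + q)) = - \<mu> - inverse K * (1 + q) * \<rho> / q"
    using q by (simp add: power_int_minus divide_simps power2_eq_square)
  show "(a \<longlongrightarrow> - \<mu> - inverse K * (1 + q) * \<rho> / q) F"
    using diag_tendsto[OF \<mu> v] unfolding eq .
  have "((\<lambda>L. (q powi M L)\<^sup>2 * GB L (x L - 1) * GD L (x L)) \<longlongrightarrow> \<rho>\<^sup>2 / (K\<^sup>2 * q)) F"
    using tendsto_mult[OF GD' GB] by (simp add: mult_ac)
  then show "(d \<longlongrightarrow> - inverse K * \<rho> * sqrt q) F"
    by (rule offdiag_tendsto)
      (use q K \<rho> in \<open>auto simp: field_simps power2_eq_square divide_nonneg_neg\<close>)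
qed

section \<open>The cases away from the axis\<close>

lemma half_power: "q powr (2 * real_of_int i + 1 / 2) = q powi (2 * i) * sqrt q"
proof -
  have "q powr (2 * real_of_int i) = q powi (2 * i)"
    using q powr_real_of_int'[of q "2 * i"] by simp
  then show ?thesis using q by (simp add: powr_add powr_half_sqrt)
qed

lemma eventually_N_pos: "\<forall>\<^sub>F L in F. N L > 0"
  by (rule slope_eventually_pos[OF F slope_params(3) pos(2)])

text \<open>With this exact value of m, the exponent m - N + 2x - S - t collapses to 2\<Delta>: the
  floors cancel and \<rho> is attained, not merely approached.\<close>

lemma right_power_limits:
  assumes "S' + t' < 2 * x'" "\<forall>\<^sub>F L in F. m L = S L + t L + N L - 2 * X L"
    and "((\<lambda>L. q powi m L) \<longlongrightarrow> \<mu>) F"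
  shows "(d \<longlongrightarrow> - K * q powr (2 * real_of_int \<Delta> + 1 / 2)) F"
    "(a \<longlongrightarrow> - \<mu> - K * (1 + q) * q powi (2 * \<Delta> + 1)) F"
proof -
  have "\<forall>\<^sub>F L in F. q powi (M L + (2 * x L - S L - t L)) = q powi (2 * \<Delta>)"
    using assms(2) by eventually_elim simp
  then have "((\<lambda>L. q powi (M L + (2 * x L - S L - t L))) \<longlongrightarrow> q powi (2 * \<Delta>)) F"
    by (rule tendsto_eventually)
  note lim = right_limits[OF assms(1) _ this assms(3)]
  show "(d \<longlongrightarrow> - K * q powr (2 * real_of_int \<Delta> + 1 / 2)) F"
    using lim(2) q unfolding half_power by (simp add: mult.assoc)
  show "(a \<longlongrightarrow> - \<mu> - K * (1 + q) * q powi (2 * \<Delta> + 1)) F"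
    using lim(1) q by (simp add: power_int_add_1 mult_ac)
qed

lemma left_power_limits:
  assumes "2 * x' < S' + t'" "\<forall>\<^sub>F L in F. m L = 2 * X L - S L - t L + N L"
    and "((\<lambda>L. q powi m L) \<longlongrightarrow> \<mu>) F"
  shows "(d \<longlongrightarrow> - inverse K * q powr (- 2 * real_of_int \<Delta> + 1 / 2)) F"
    "(a \<longlongrightarrow> - \<mu> - inverse K * (1 + q) * q powi (- 2 * \<Delta> - 1)) F"
proof -
  \<comment> \<open>The exponent is kept in this form so that \<open>half_power\<close> applies to
    \<open>- \<Delta>\<close>.\<close>
  have "\<forall>\<^sub>F L in F. q powi (M L + (S L + t L - 2 * x L)) = q powi (2 * (- \<Delta>))"
    using assms(2) by eventually_elim simp
  then have "((\<lambda>L. q powi (M L + (S L + t L - 2 * x L))) \<longlongrightarrow> q powi (2 * (- \<Delta>))) F"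
    by (rule tendsto_eventually)
  note lim = left_limits[OF assms(1) _ this assms(3)]
  have "- 2 * real_of_int \<Delta> = 2 * real_of_int (- \<Delta>)" by simp
  then show "(d \<longlongrightarrow> - inverse K * q powr (- 2 * real_of_int \<Delta> + 1 / 2)) F"
    using lim(2) q unfolding half_power by (simp only: half_power) (simp add: mult.assoc)
  have "q powi (2 * (- \<Delta>)) / q = q powi (- 2 * \<Delta> - 1)"
    using q by (simp add: power_int_diff)
  with lim(1) q show "(a \<longlongrightarrow> - \<mu> - inverse K * (1 + q) * q powi (- 2 * \<Delta> - 1)) F"
    by (simp flip: times_divide_eq_right)
qed

text \<open>Beyond the edges m is eventually 0, so \<mu> = 1, while the exponent defining \<rho> has
  the positive slope |2x' - S' - t'| - N', so \<rho> = 0.\<close>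

lemma outer_limits:
  assumes "N' < \<bar>2 * x' - S' - t'\<bar>"
  shows "(d \<longlongrightarrow> 0) F" "(a \<longlongrightarrow> - 1) F"
proof -
  have "\<forall>\<^sub>F L in F. \<bar>2 * X L - S L - t L\<bar> - N L > 0"
    by (rule slope_eventually_pos[OF F], (rule slopes)+) (use assms in linarith)
  then have m: "\<forall>\<^sub>F L in F. m L = 0"
    by eventually_elim (simp add: scale_exp_def)
  then have \<mu>: "((\<lambda>L. q powi m L) \<longlongrightarrow> 1) F"
    by (intro tendsto_eventually) (auto elim: eventually_mono)
  have sM: "slope F M (- N')"
    using slope_diff[OF slope_m slope_params(3)] assms by simp
  have "(a \<longlongrightarrow> - 1) F \<and> (d \<longlongrightarrow> 0) F"
  proof (cases "S' + t' < 2 * x'")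
    case True
    have "((\<lambda>L. q powi (M L + (2 * x L - S L - t L))) \<longlongrightarrow> 0) F"
      by (rule powi_tendsto_0, (rule sM slopes)+)
        (simp only: add_0_right, use assms True in linarith)
    from right_limits[OF True _ this \<mu>] show ?thesis by simp
  next
    case False
    then have left: "2 * x' < S' + t'" using assms pos by linarith
    have "((\<lambda>L. q powi (M L + (S L + t L - 2 * x L))) \<longlongrightarrow> 0) F"
      by (rule powi_tendsto_0, (rule sM slopes)+)
        (simp only: add_0_right, use assms left in linarith)
    from left_limits[OF left _ this \<mu>] show ?thesis by simp
  qed
  then show "(d \<longlongrightarrow> 0) F" "(a \<longlongrightarrow> - 1) F" by simp_all
qed

lemma edge_scale:
  assumes "\<forall>\<^sub>F L in F. \<bar>2 * X L - S L - t L\<bar> = N L"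
  shows "\<forall>\<^sub>F L in F. m L = 0" "((\<lambda>L. q powi m L) \<longlongrightarrow> 1) F"
proof -
  show *: "\<forall>\<^sub>F L in F. m L = 0"
    using assms by eventually_elim (simp add: scale_exp_def)
  then show "((\<lambda>L. q powi m L) \<longlongrightarrow> 1) F"
    by (intro tendsto_eventually) (auto elim: eventually_mono)
qed

text \<open>Between the edges m has positive slope, so \<open>q powi m\<close> tends to 0 and the
  summand -1 of the diagonal limit disappears. This is all that separates the inner limits from the
  edge limits.\<close>

lemma inner_scale:
  assumes "\<bar>2 * x' - S' - t'\<bar> < N'"
  shows "\<forall>\<^sub>F L in F. m L = N L - \<bar>2 * X L - S L - t L\<bar>" "((\<lambda>L. q powi m L) \<longlongrightarrow> 0) F"
proof -
  have "\<forall>\<^sub>F L in F. N L - \<bar>2 * X L - S L - t L\<bar> > 0"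
    by (rule slope_eventually_pos[OF F], (rule slopes)+) (use assms in linarith)
  then show "\<forall>\<^sub>F L in F. m L = N L - \<bar>2 * X L - S L - t L\<bar>"
    by eventually_elim (simp add: scale_exp_def)
  show "((\<lambda>L. q powi m L) \<longlongrightarrow> 0) F"
    by (rule powi_tendsto_0[OF slope_m]) (use assms in linarith)
qed

lemma right_edge_limits:
  assumes "2 * x' = S' + t' + N'" "\<forall>\<^sub>F L in F. 2 * X L = S L + t L + N L"
  shows "(d \<longlongrightarrow> - K * q powr (2 * real_of_int \<Delta> + 1 / 2)) F"
    "(a \<longlongrightarrow> - 1 - K * (1 + q) * q powi (2 * \<Delta> + 1)) F"
proof -
  have "\<forall>\<^sub>F L in F. \<bar>2 * X L - S L - t L\<bar> = N L"
    using assms(2) eventually_N_pos by eventually_elim simp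
  note edge = edge_scale[OF this]
  have "\<forall>\<^sub>F L in F. m L = S L + t L + N L - 2 * X L"
    using edge(1) assms(2) by eventually_elim simp
  from right_power_limits[OF _ this edge(2)] assms(1) pos
  show "(d \<longlongrightarrow> - K * q powr (2 * real_of_int \<Delta> + 1 / 2)) F"
    "(a \<longlongrightarrow> - 1 - K * (1 + q) * q powi (2 * \<Delta> + 1)) F" by simp_all
qed

lemma left_edge_limits:
  assumes "2 * x' = S' + t' - N'" "\<forall>\<^sub>F L in F. 2 * X L = S L + t L - N L"
  shows "(d \<longlongrightarrow> - inverse K * q powr (- 2 * real_of_int \<Delta> + 1 / 2)) F"
    "(a \<longlongrightarrow> - 1 - inverse K * (1 + q) * q powi (- 2 * \<Delta> - 1)) F"
proof -
  have "\<forall>\<^sub>F L in F. \<bar>2 * X L - S L - t L\<bar> = N L"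
    using assms(2) eventually_N_pos by eventually_elim simp
  note edge = edge_scale[OF this]
  have "\<forall>\<^sub>F L in F. m L = 2 * X L - S L - t L + N L"
    using edge(1) assms(2) by eventually_elim simp
  from left_power_limits[OF _ this edge(2)] assms(1) pos
  show "(d \<longlongrightarrow> - inverse K * q powr (- 2 * real_of_int \<Delta> + 1 / 2)) F"
    "(a \<longlongrightarrow> - 1 - inverse K * (1 + q) * q powi (- 2 * \<Delta> - 1)) F" by simp_all
qed

lemma right_inner_limits:
  assumes "S' + t' < 2 * x'" "2 * x' < S' + t' + N'"
  shows "(d \<longlongrightarrow> - K * q powr (2 * real_of_int \<Delta> + 1 / 2)) F"
    "(a \<longlongrightarrow> - K * (1 + q) * q powi (2 * \<Delta> + 1)) F"
proof -
  have "\<bar>2 * x' - S' - t'\<bar> < N'" using assms by linarith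
  note inner = inner_scale[OF this]
  have "\<forall>\<^sub>F L in F. 2 * X L - S L - t L > 0"
    by (rule slope_eventually_pos[OF F], (rule slopes)+) (use assms in linarith)
  with inner(1) have "\<forall>\<^sub>F L in F. m L = S L + t L + N L - 2 * X L"
    by eventually_elim simp
  from right_power_limits[OF assms(1) this inner(2)]
  show "(d \<longlongrightarrow> - K * q powr (2 * real_of_int \<Delta> + 1 / 2)) F"
    "(a \<longlongrightarrow> - K * (1 + q) * q powi (2 * \<Delta> + 1)) F" by simp_all
qed

lemma left_inner_limits:
  assumes "S' + t' - N' < 2 * x'" "2 * x' < S' + t'"
  shows "(d \<longlongrightarrow> - inverse K * q powr (- 2 * real_of_int \<Delta> + 1 / 2)) F"
    "(a \<longlongrightarrow> - inverse K * (1 + q) * q powi (- 2 * \<Delta> - 1)) F"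
proof -
  have "\<bar>2 * x' - S' - t'\<bar> < N'" using assms by linarith
  note inner = inner_scale[OF this]
  have "\<forall>\<^sub>F L in F. S L + t L - 2 * X L > 0"
    by (rule slope_eventually_pos[OF F], (rule slopes)+) (use assms in linarith)
  with inner(1) have "\<forall>\<^sub>F L in F. m L = 2 * X L - S L - t L + N L"
    by eventually_elim simp
  from left_power_limits[OF assms(2) this inner(2)]
  show "(d \<longlongrightarrow> - inverse K * q powr (- 2 * real_of_int \<Delta> + 1 / 2)) F"
    "(a \<longlongrightarrow> - inverse K * (1 + q) * q powi (- 2 * \<Delta> - 1)) F" by simp_all
qed

section \<open>The axis 2x' = S' + t'\<close>

text \<open>The integer identity gives m = N, so the prefactor \<open>q powi M\<close> is eventually
  1 and nothing diverges. The last arguments of the factors of B and D are eventually constant and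
  positive, hence both factors have nontrivial limits.\<close>

lemma center_limits:
  assumes center: "2 * x' = S' + t'" "\<forall>\<^sub>F L in F. 2 * X L = S L + t L"
  shows "(d \<longlongrightarrow> - K * q powr (2 * real_of_int \<Delta> + 1 / 2)
      / ((1 - K * q powi (2 * \<Delta>))
         * sqrt ((1 - K * q powi (2 * \<Delta> - 1)) * (1 - K * q powi (2 * \<Delta> + 1))))) F"
    "(a \<longlongrightarrow> - K * (1 + q) * q powi (2 * \<Delta> + 1)
      / ((1 - K * q powi (2 * \<Delta>)) * (1 - K * q powi (2 * \<Delta> + 2)))) F"
proof -
  have "\<bar>2 * x' - S' - t'\<bar> < N'" using center pos by linarith
  note inner = inner_scale[OF this]
  have "\<forall>\<^sub>F L in F. q powi M L = 1"
    using inner(1) center(2) by eventually_elim simp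
  then have M: "((\<lambda>L. q powi M L) \<longlongrightarrow> 1) F" by (rule tendsto_eventually)
  define p where "p = q powi (2 * \<Delta>)"
  have p: "p > 0" using q by (simp add: p_def)
  have qp: "q powi (2 * \<Delta> + 1) = p * q" "q powi (2 * \<Delta> - 1) = p / q" "q powi (2 * \<Delta> + 2) = p * q\<^sup>2"
    "q powi (- 2 * \<Delta>) = inverse p" "q powi (- 2 * \<Delta> - 2) = inverse p / q\<^sup>2"
    using q by (simp_all add: p_def power_int_add power_int_diff power_int_minus power2_eq_square)
  have Kp: "K * p < 0" "K * p * q < 0" "K * p * q\<^sup>2 < 0" "K * p / q < 0"
    using K p q by (simp_all add: mult_neg_pos divide_neg_pos)
  have r: "((\<lambda>L. q powi (2 * x L - S L - t L)) \<longlongrightarrow> p) F"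
    unfolding p_def by (rule tendsto_eventually) (use center(2) in eventually_elim, simp)
  have rB: "((\<lambda>L. q powi (S L + t L - 2 * x L - 2)) \<longlongrightarrow> q powi (- 2 * \<Delta> - 2)) F"
    by (rule tendsto_eventually) (use center(2) in eventually_elim, simp)
  have rB': "((\<lambda>L. q powi (S L + t L - 2 * (x L - 1) - 2)) \<longlongrightarrow> q powi (- 2 * \<Delta>)) F"
    by (rule tendsto_eventually) (use center(2) in eventually_elim, simp)
  have GD: "((\<lambda>L. GD L (x L)) \<longlongrightarrow> 1 / ((1 - K * p) * (1 - K * p * q))) F"
    unfolding D_quot_def
    by (rule racah_quot_tendsto; (rule r | (rule powi_tendsto_0, (rule slopes)+) | use Kp in simp))
      (simp only: add_0_right diff_zero, use center hex triangle pos in linarith)+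
  have GB: "((\<lambda>L. GB L (x L)) \<longlongrightarrow> 1 / ((1 - inverse K * q powi (- 2 * \<Delta> - 2))
      * (1 - inverse K * q powi (- 2 * \<Delta> - 2) * q))) F"
    unfolding B_quot_def
    by (rule racah_quot_tendsto; (rule rB denom | (rule powi_tendsto_0, (rule slopes)+)))
      (simp only: add_0_right diff_zero, use center hex triangle pos in linarith)+
  have GB': "((\<lambda>L. GB L (x L - 1)) \<longlongrightarrow> 1 / ((1 - inverse K * q powi (- 2 * \<Delta>))
      * (1 - inverse K * q powi (- 2 * \<Delta>) * q))) F"
    unfolding B_quot_def
    by (rule racah_quot_tendsto; (rule rB' denom | (rule powi_tendsto_0, (rule slopes)+)))
      (simp only: add_0_right diff_zero, use center hex triangle pos in linarith)+
  have nz: "K * p \<noteq> 1" "K * p * q \<noteq> 1" "K * p * q\<^sup>2 \<noteq> 1" "K * p \<noteq> q" "K \<noteq> 0" "p \<noteq> 0" "q \<noteq> 0"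
    using Kp K p q by auto
  \<comment> \<open>Clearing \<open>inverse K\<close> expresses the limits of B through the linear
    factors in K p that also occur in the limit of D.\<close>
  have eB: "1 / ((1 - inverse K * q powi (- 2 * \<Delta> - 2)) * (1 - inverse K * q powi (- 2 * \<Delta> - 2) * q))
      = (K * p)\<^sup>2 * q ^ 3 / ((1 - K * p * q\<^sup>2) * (1 - K * p * q))"
    using nz unfolding qp by (simp add: divide_simps power2_eq_square power3_eq_cube) algebra
  have eB': "1 / ((1 - inverse K * q powi (- 2 * \<Delta>)) * (1 - inverse K * q powi (- 2 * \<Delta>) * q))
      = (K * p)\<^sup>2 / q / ((1 - K * p) * (1 - K * p / q))"
    using nz unfolding qp by (simp add: divide_simps power2_eq_square power3_eq_cube) algebra
  \<comment> \<open>The two fractions share the factor 1 - K p q in the denominator; it cancels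
    after the subtraction from 1.\<close>
  have "q * (1 - (K * p)\<^sup>2 * q ^ 3 / ((1 - K * p * q\<^sup>2) * (1 - K * p * q))
       - 1 / ((1 - K * p) * (1 - K * p * q)))
     = - K * (1 + q) * (p * q) / ((1 - K * p) * (1 - K * p * q\<^sup>2))"
    using nz by (simp add: divide_simps) algebra
  moreover have "(a \<longlongrightarrow> - 0 + q * (1 * (1 - (K * p)\<^sup>2 * q ^ 3 / ((1 - K * p * q\<^sup>2) * (1 - K * p * q))
       - 1 / ((1 - K * p) * (1 - K * p * q))))) F"
    by (intro diag_tendsto inner(2) tendsto_mult M tendsto_diff tendsto_const GB[unfolded eB] GD)
  ultimately show "(a \<longlongrightarrow> - K * (1 + q) * q powi (2 * \<Delta> + 1)
      / ((1 - K * q powi (2 * \<Delta>)) * (1 - K * q powi (2 * \<Delta> + 2)))) F"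
    unfolding qp p_def[symmetric] by (simp add: mult.assoc)
  have pos': "1 - K * p > 0" "(1 - K * (p / q)) * (1 - K * (p * q)) > 0"
    using Kp by (auto intro!: mult_pos_pos simp: mult.assoc)
  show "(d \<longlongrightarrow> - K * q powr (2 * real_of_int \<Delta> + 1 / 2)
      / ((1 - K * q powi (2 * \<Delta>))
         * sqrt ((1 - K * q powi (2 * \<Delta> - 1)) * (1 - K * q powi (2 * \<Delta> + 1))))) F"
  proof (rule offdiag_tendsto)
    show "((\<lambda>L. (q powi M L)\<^sup>2 * GB L (x L - 1) * GD L (x L)) \<longlongrightarrow>
       1\<^sup>2 * ((K * p)\<^sup>2 / q / ((1 - K * p) * (1 - K * p / q))) * (1 / ((1 - K * p) * (1 - K * p * q)))) F"
      by (intro tendsto_mult tendsto_power M GB'[unfolded eB'] GD)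
    have eq: "(- K * (p * sqrt q) / ((1 - K * p) * sqrt ((1 - K * (p / q)) * (1 - K * (p * q)))))\<^sup>2
        = K\<^sup>2 * (p\<^sup>2 * q) / ((1 - K * p)\<^sup>2 * ((1 - K * (p / q)) * (1 - K * (p * q))))"
      using pos' q by (simp only: power_divide power_mult_distrib power2_minus real_sqrt_pow2 less_imp_le)
    show "q\<^sup>2 * (1\<^sup>2 * ((K * p)\<^sup>2 / q / ((1 - K * p) * (1 - K * p / q))) * (1 / ((1 - K * p) * (1 - K * p * q))))
      = (- K * q powr (2 * real_of_int \<Delta> + 1 / 2) / ((1 - K * q powi (2 * \<Delta>))
         * sqrt ((1 - K * q powi (2 * \<Delta> - 1)) * (1 - K * q powi (2 * \<Delta> + 1)))))\<^sup>2"
      unfolding half_power qp p_def[symmetric] eq using q by (simp add: power2_eq_square mult_ac)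
    show "0 \<le> - K * q powr (2 * real_of_int \<Delta> + 1 / 2) / ((1 - K * q powi (2 * \<Delta>))
         * sqrt ((1 - K * q powi (2 * \<Delta> - 1)) * (1 - K * q powi (2 * \<Delta> + 1))))"
      unfolding half_power qp p_def[symmetric] using pos' p q K
      by (intro divide_nonneg_nonneg mult_nonneg_nonneg) auto
  qed
qed

end

section \<open>Passage from the locale to the six cases\<close>

theorem proposition1p3:
  fixes q K T' S' N' t' x' :: real and \<kappa> :: complex
    and T S N t X :: "real \<Rightarrow> int" and w :: "real \<Rightarrow> int \<Rightarrow> real" and \<Delta> :: int
    and a d :: "real \<Rightarrow> real"
  assumes "0 < q" "q < 1"
    and "Re \<kappa> = 0" "Im \<kappa> > 0" and "complex_of_real K = \<kappa>\<^sup>2"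
    and "T' > S'" "S' > 0" "T' > N'" "N' > 0"
    and "t_left S' N' < t'" "t' < t_right T' S' N'"
    and "(t', x') \<in> hexagon T' S' N'"
    and "\<And>L. T L = \<lfloor>L * T'\<rfloor>" "\<And>L. S L = \<lfloor>L * S'\<rfloor>" "\<And>L. N L = \<lfloor>L * N'\<rfloor>"
    and "\<And>L. t L = \<lfloor>L * t'\<rfloor>" "\<And>L. X L = \<lfloor>L * x'\<rfloor>"
    and "\<And>L. L > 0 \<Longrightarrow> racah_weight q K (T L) (S L) (N L) (t L) (w L)"
    and "\<And>L. a L = diag_coeff q K (T L) (S L) (N L) (t L) (X L) \<Delta>"
    and "\<And>L. d L = offdiag_coeff q K (T L) (S L) (N L) (t L) (w L) (X L) \<Delta>"
  shows
    "(\<bar>2 * x' - S' - t'\<bar> > N' \<longrightarrow>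
        (d \<longlongrightarrow> 0) at_top \<and> (a \<longlongrightarrow> -1) at_top) \<and>
     (2 * x' = S' + t' + N' \<longrightarrow>
        (let F = inf at_top (principal {L. real_of_int (X L) = real_of_int (S L + t L + N L) / 2})
         in (d \<longlongrightarrow> - K * q powr (2 * real_of_int \<Delta> + 1/2)) F \<and>
            (a \<longlongrightarrow> -1 - K * (1 + q) * q powi (2 * \<Delta> + 1)) F)) \<and>
     (2 * x' = S' + t' - N' \<longrightarrow>
        (let F = inf at_top (principal {L. real_of_int (X L) = real_of_int (S L + t L - N L) / 2})
         in (d \<longlongrightarrow> - inverse K * q powr (- 2 * real_of_int \<Delta> + 1/2)) F \<and>
            (a \<longlongrightarrow> -1 - inverse K * (1 + q) * q powi (- 2 * \<Delta> - 1)) F)) \<and>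
     (S' + t' < 2 * x' \<and> 2 * x' < S' + t' + N' \<longrightarrow>
        (d \<longlongrightarrow> - K * q powr (2 * real_of_int \<Delta> + 1/2)) at_top \<and>
        (a \<longlongrightarrow> - K * (1 + q) * q powi (2 * \<Delta> + 1)) at_top) \<and>
     (S' + t' - N' < 2 * x' \<and> 2 * x' < S' + t' \<longrightarrow>
        (d \<longlongrightarrow> - inverse K * q powr (- 2 * real_of_int \<Delta> + 1/2)) at_top \<and>
        (a \<longlongrightarrow> - inverse K * (1 + q) * q powi (- 2 * \<Delta> - 1)) at_top) \<and>
     (2 * x' = S' + t' \<longrightarrow>
        (let F = inf at_top (principal {L. real_of_int (X L) = real_of_int (S L + t L) / 2})
         in (d \<longlongrightarrow> - K * q powr (2 * real_of_int \<Delta> + 1/2)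
                / ((1 - K * q powi (2 * \<Delta>))
                   * sqrt ((1 - K * q powi (2 * \<Delta> - 1)) * (1 - K * q powi (2 * \<Delta> + 1))))) F \<and>
            (a \<longlongrightarrow> - K * (1 + q) * q powi (2 * \<Delta> + 1)
                / ((1 - K * q powi (2 * \<Delta>)) * (1 - K * q powi (2 * \<Delta> + 2)))) F))"
proof -
  have \<kappa>: "\<kappa> = \<i> * Im \<kappa>" using assms(3) by (simp add: complex_eq_iff)
  have "complex_of_real K = complex_of_real (- (Im \<kappa>)\<^sup>2)"
    unfolding assms(5) by (subst \<kappa>) (simp add: power_mult_distrib)
  then have "K = - (Im \<kappa>)\<^sup>2" by (simp only: of_real_eq_iff)
  then have K: "K < 0" using assms(4) by simp
  have lim: "racah_limit q K T' S' N' t' x' T S N t X w F" if "F \<le> at_top" for F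
    by unfold_locales
      (use assms that K in \<open>auto simp: t_left_def t_right_def hexagon_def fun_eq_iff\<close>)
  have a: "a = (\<lambda>L. diag_coeff q K (T L) (S L) (N L) (t L) (X L) \<Delta>)"
    and d: "d = (\<lambda>L. offdiag_coeff q K (T L) (S L) (N L) (t L) (w L) (X L) \<Delta>)"
    using assms by (simp_all add: fun_eq_iff)
  \<comment> \<open>A border case runs along \<open>at_top\<close> restricted to the set where its
    identity holds: this filter lies below \<open>at_top\<close>, and on it the identity holds
    eventually.\<close>
  have F: "inf at_top (principal A) \<le> at_top"
    "(\<And>L. L \<in> A \<Longrightarrow> P L) \<Longrightarrow> \<forall>\<^sub>F L in inf at_top (principal A). P L"
    for A :: "real set" and P
    by (auto simp: eventually_inf_principal)
  \<comment> \<open>The identities with a real half are turned into the integer identities assumed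
    by the border lemmas.\<close>
  have half: "real_of_int i = real_of_int j / 2 \<longleftrightarrow> 2 * i = j" for i j by linarith
  note top = lim[OF order_refl] and inf = lim[OF F(1)]
  show ?thesis
    unfolding a d Let_def half
    by (intro conjI impI; (elim conjE)?;
        (rule racah_limit.outer_limits[OF top] racah_limit.right_inner_limits[OF top]
          racah_limit.left_inner_limits[OF top] racah_limit.right_edge_limits[OF inf]
          racah_limit.left_edge_limits[OF inf] racah_limit.center_limits[OF inf];
         (assumption | rule F(2) | simp)+))
qed

end
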